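(* Let $p$ be an odd prime. The zeros of $f_p(t)$ in $\mathbb{C}$, other than at $0$, $1$ and $-1$, come in pairs $\alpha, 1/\alpha$. Moreover, all zeros of $f_p$ other than $0$ lie in the annulus $\{r\in\mathbb{C} : \frac12 < |r| < 2\}$.
   Context: For an odd prime $p$, $\left(\frac{\cdot}{p}\right)$ denotes the Legendre symbol and the Fekete polynomial is $f_p(t) := \sum_{a=0}^{p-1} \left(\frac{a}{p}\right) t^a$. *)

theory Defs
  imports
    Complex_Main
    "HOL-Computational_Algebra.Polynomial"
    "HOL-Number_Theory.Residues"
begin

definition fekete_poly :: "nat \<Rightarrow> complex poly" where
  "fekete_poly p = (\<Sum>a = 0..p-1. Polynomial.monom (of_int (Legendre (int a) (int p))) a)"

end

theory Submission
  imports Defs "HOL-Number_Theory.Euler_Criterion"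
begin

text \<open>
  Up to the factor t, the polynomial f of an odd prime p is self-reciprocal: since
  the Legendre symbol is multiplicative, the coefficient of index p - a is that of index a
  times the sign (-1/p), so reversing the coefficients of f gives (-1/p) f(t) / t
  (\<open>pCons_reflect_fekete\<close>). Reversal carries a zero \<alpha> \<noteq> 0 to 1 / \<alpha>
  without lowering its multiplicity, so \<alpha> and 1 / \<alpha> are zeros of f of the
  same multiplicity (\<open>order_fekete_inverse\<close>); they are distinct unless \<alpha> = 1 or \<alpha> = -1.

  All coefficients of f have absolute value at most 1 and the leading one is a sign.
  If |\<alpha>| \<ge> 2, then the leading term exceeds in absolute value the geometric sum that
  bounds all the others, so \<alpha> is not a zero. The lower bound 1/2 is this upper bound
  applied to the zero 1 / \<alpha>.
\<close>

section \<open>Multiplicativity of the Legendre symbol\<close>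

lemma Legendre_cases: "Legendre a p \<in> {-1, 0, 1}"
  by (simp add: Legendre_def)

lemma Legendre_eq_0_iff: "Legendre a p = 0 \<longleftrightarrow> p dvd a"
  by (simp add: Legendre_def cong_0_iff)

lemma Legendre_cong:
  assumes "[a = b] (mod p)"
  shows "Legendre a p = Legendre b p"
proof -
  have "[a = c] (mod p) \<longleftrightarrow> [b = c] (mod p)" and "[c = a] (mod p) \<longleftrightarrow> [c = b] (mod p)" for c
    using assms by (meson cong_sym cong_trans)+
  then show ?thesis
    by (simp add: Legendre_def QuadRes_def)
qed

text \<open>
  By Euler's criterion both sides are congruent to the same power of ab modulo p, and
  elements of {-1, 0, 1} that are congruent modulo p > 2 are equal.
\<close>

lemma Legendre_mult:
  fixes p :: nat
  assumes "prime p" "2 < p"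
  shows "Legendre (a * b) (int p) = Legendre a (int p) * Legendre b (int p)"
proof -
  let ?x = "Legendre (a * b) (int p)" and ?y = "Legendre a (int p) * Legendre b (int p)"
  have "[?y = a ^ ((p - 1) div 2) * b ^ ((p - 1) div 2)] (mod int p)"
    by (intro cong_mult euler_criterion assms)
  then have "[?y = (a * b) ^ ((p - 1) div 2)] (mod int p)"
    by (simp add: power_mult_distrib)
  then have "[?x = ?y] (mod int p)"
    using euler_criterion[OF assms, of "a * b"] by (meson cong_sym cong_trans)
  then have dvd: "int p dvd ?x - ?y"
    by (simp add: cong_iff_dvd_diff)
  (* A nonzero multiple of p would have absolute value at least p > 2. *)
  have "\<bar>?x - ?y\<bar> \<le> 2"
    using Legendre_cases[of "a * b" "int p"] Legendre_cases[of a "int p"] Legendre_cases[of b "int p"]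
    by auto
  then have "?x - ?y = 0"
    using dvd \<open>2 < p\<close> zdvd_imp_le[of "int p" "\<bar>?x - ?y\<bar>"] by (cases "?x - ?y = 0") auto
  then show ?thesis
    by simp
qed

lemma Legendre_reflect:
  fixes p a :: nat
  assumes "prime p" "2 < p" "a \<le> p"
  shows "Legendre (int (p - a)) (int p) = Legendre (-1) (int p) * Legendre (int a) (int p)"
proof -
  have "[int (p - a) = -1 * int a] (mod int p)"
    using \<open>a \<le> p\<close> by (simp add: cong_iff_dvd_diff of_nat_diff)
  then show ?thesis
    using Legendre_cong Legendre_mult[OF assms(1,2)] by metis
qed


section \<open>Reversal of coefficients and multiplicities of zeros\<close>

lemma reflect_poly_linear:
  fixes a :: "'a :: field"
  assumes "a \<noteq> 0"
  shows "reflect_poly [:-a, 1:] = Polynomial.smult (-a) [:- (1 / a), 1:]"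
  using assms by (simp add: reflect_poly_pCons)

text \<open>
  Reversal is multiplicative, so it turns a power of the linear factor of \<alpha> that divides q
  into a power of the linear factor of 1 / \<alpha> that divides the reversed polynomial.
\<close>

lemma order_le_order_reflect_poly:
  fixes q :: "'a :: field poly"
  assumes "a \<noteq> 0" "q \<noteq> 0"
  shows "Polynomial.order a q \<le> Polynomial.order (1 / a) (reflect_poly q)"
proof -
  let ?n = "Polynomial.order a q"
  obtain r where "q = [:-a, 1:] ^ ?n * r"
    using order_1[of a q] by (elim dvdE)
  then have "reflect_poly q = reflect_poly [:-a, 1:] ^ ?n * reflect_poly r"
    by (metis reflect_poly_mult reflect_poly_power)
  also have "\<dots> = [:- (1 / a), 1:] ^ ?n * Polynomial.smult ((-a) ^ ?n) (reflect_poly r)"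
    by (simp only: reflect_poly_linear[OF \<open>a \<noteq> 0\<close>] smult_power mult_smult_left mult_smult_right)
  finally have "[:- (1 / a), 1:] ^ ?n dvd reflect_poly q"
    by (rule dvdI)
  then show ?thesis
    using \<open>q \<noteq> 0\<close> by (simp add: order_divides)
qed


section \<open>A bound for the zeros of a polynomial with small coefficients\<close>

lemma sum_powers_less_power:
  fixes r :: real
  assumes "2 \<le> r"
  shows "(\<Sum>i<n. r ^ i) < r ^ n"
proof (induction n)
  case (Suc n)
  have "(\<Sum>i<Suc n. r ^ i) < 2 * r ^ n"
    using Suc by simp
  also have "\<dots> \<le> r ^ Suc n"
    using assms by simp
  finally show ?case .
qed simp

text \<open>
  From |z| \<ge> 2 on, the leading term dominates all the others together, so they cannot cancel it.
\<close>

lemma norm_root_less_2: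
  fixes q :: "'a :: real_normed_field poly"
  assumes root: "poly q z = 0"
    and coeffs: "\<And>i. norm (Polynomial.coeff q i) \<le> 1" and lead: "norm (lead_coeff q) = 1"
  shows "norm z < 2"
proof (rule ccontr)
  assume "\<not> norm z < 2"
  then have "2 \<le> norm z" by simp
  let ?n = "Polynomial.degree q"
  have "poly q z = (\<Sum>i<?n. Polynomial.coeff q i * z ^ i) + lead_coeff q * z ^ ?n"
    by (simp add: poly_altdef lessThan_Suc_atMost[symmetric])
  then have "lead_coeff q * z ^ ?n = - (\<Sum>i<?n. Polynomial.coeff q i * z ^ i)"
    using root by (simp add: eq_neg_iff_add_eq_0 add.commute)
  then have "norm (lead_coeff q * z ^ ?n) = norm (\<Sum>i<?n. Polynomial.coeff q i * z ^ i)"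
    by simp
  then have "norm z ^ ?n = norm (\<Sum>i<?n. Polynomial.coeff q i * z ^ i)"
    by (simp add: norm_mult norm_power lead)
  also have "\<dots> \<le> (\<Sum>i<?n. norm z ^ i)"
    by (intro sum_norm_le) (simp add: norm_mult norm_power coeffs mult_left_le_one_le)
  also have "\<dots> < norm z ^ ?n"
    using \<open>2 \<le> norm z\<close> by (rule sum_powers_less_power)
  finally show False by simp
qed


section \<open>The symmetry of the Fekete polynomial\<close>

lemma coeff_fekete_poly:
  "Polynomial.coeff (fekete_poly p) i = (if i \<le> p - 1 then of_int (Legendre (int i) (int p)) else 0)"
  by (simp add: fekete_poly_def coeff_sum)

lemma norm_coeff_fekete_le: "norm (Polynomial.coeff (fekete_poly p) i) \<le> 1"
  using Legendre_cases[of "int i" "int p"] by (auto simp: coeff_fekete_poly)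

lemma norm_of_int_Legendre:
  assumes "\<not> p dvd a"
  shows "norm (of_int (Legendre a p) :: complex) = 1"
  using assms Legendre_cases[of a p] Legendre_eq_0_iff[of a p] by auto

lemma norm_coeff_fekete_last:
  assumes "prime p"
  shows "norm (Polynomial.coeff (fekete_poly p) (p - 1)) = 1"
proof -
  have "\<not> int p dvd int (p - 1)"
    using prime_gt_1_nat[OF assms] by (auto dest!: zdvd_imp_le)
  then show ?thesis
    using norm_of_int_Legendre by (simp only: coeff_fekete_poly order_refl if_True)
qed

lemma degree_fekete_poly:
  assumes "prime p"
  shows "Polynomial.degree (fekete_poly p) = p - 1"
proof (rule antisym)
  show "Polynomial.degree (fekete_poly p) \<le> p - 1"
    by (rule degree_le) (simp add: coeff_fekete_poly)
  show "p - 1 \<le> Polynomial.degree (fekete_poly p)"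
    using norm_coeff_fekete_last[OF assms] by (intro le_degree) auto
qed

lemma fekete_poly_nonzero:
  assumes "prime p"
  shows "fekete_poly p \<noteq> 0"
  using norm_coeff_fekete_last[OF assms] by auto

text \<open>
  The coefficient of index 0 vanishes and the degree is p - 1, so reversal moves index a to
  p - 1 - a. The extra factor t on the left turns this into p - a, which is -a modulo p.
\<close>

lemma pCons_reflect_fekete:
  assumes "prime p" "2 < p"
  shows "pCons 0 (reflect_poly (fekete_poly p)) =
    Polynomial.smult (of_int (Legendre (-1) (int p))) (fekete_poly p)"
proof (rule poly_eqI)
  fix i
  show "Polynomial.coeff (pCons 0 (reflect_poly (fekete_poly p))) i =
    Polynomial.coeff (Polynomial.smult (of_int (Legendre (-1) (int p))) (fekete_poly p)) i"
  proof (cases i)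
    case 0
    then show ?thesis
      by (simp add: coeff_fekete_poly Legendre_eq_0_iff)
  next
    case (Suc j)
    then show ?thesis
      using Legendre_reflect[OF assms, of i]
      by (auto simp: coeff_reflect_poly degree_fekete_poly[OF assms(1)] coeff_fekete_poly
          Legendre_eq_0_iff)
  qed
qed

lemma order_reflect_fekete:
  assumes "prime p" "2 < p" "b \<noteq> 0"
  shows "Polynomial.order b (reflect_poly (fekete_poly p)) = Polynomial.order b (fekete_poly p)"
proof -
  let ?f = "fekete_poly p"
  have "\<not> int p dvd - 1"
    using \<open>2 < p\<close> by simp
  then have sign: "of_int (Legendre (-1) (int p)) \<noteq> (0 :: complex)"
    by (simp add: Legendre_eq_0_iff)
  have "reflect_poly ?f \<noteq> 0"
    using fekete_poly_nonzero[OF assms(1)] by simp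
  then have "Polynomial.order b ([:0, 1:] * reflect_poly ?f) =
      Polynomial.order b [:0, 1:] + Polynomial.order b (reflect_poly ?f)"
    by (intro order_mult) simp
  moreover have "Polynomial.order b [:0, 1:] = 0"
    using \<open>b \<noteq> 0\<close> by (intro order_0I) simp
  moreover have "[:0, 1:] * reflect_poly ?f = Polynomial.smult (of_int (Legendre (-1) (int p))) ?f"
    using pCons_reflect_fekete[OF assms(1,2)] by simp
  ultimately show ?thesis
    using sign by (simp add: order_smult)
qed

text \<open>
  One inequality suffices: inversion is an involution, so applying it to 1 / \<alpha> gives the other one.
\<close>

lemma order_fekete_inverse:
  assumes "prime p" "2 < p" "a \<noteq> 0"
  shows "Polynomial.order (1 / a) (fekete_poly p) = Polynomial.order a (fekete_poly p)"
proof -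
  have le: "Polynomial.order b (fekete_poly p) \<le> Polynomial.order (1 / b) (fekete_poly p)" if "b \<noteq> 0" for b
    using order_le_order_reflect_poly[OF that fekete_poly_nonzero[OF assms(1)]]
      order_reflect_fekete[OF assms(1,2), of "1 / b"] that by simp
  from le[of a] le[of "1 / a"] \<open>a \<noteq> 0\<close> show ?thesis
    by simp
qed

lemma poly_fekete_inverse_eq_0_iff:
  assumes "prime p" "2 < p" "a \<noteq> 0"
  shows "poly (fekete_poly p) (1 / a) = 0 \<longleftrightarrow> poly (fekete_poly p) a = 0"
  using order_fekete_inverse[OF assms] fekete_poly_nonzero[OF assms(1)] by (simp add: order_root)

lemma norm_fekete_root_less_2:
  assumes "prime p" "poly (fekete_poly p) a = 0"
  shows "norm a < 2"
  using assms(2) norm_coeff_fekete_le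
  by (rule norm_root_less_2) (simp only: degree_fekete_poly norm_coeff_fekete_last assms(1))


section \<open>The zeros of the Fekete polynomial\<close>

theorem proposition1:
  fixes p :: nat
  assumes "prime p" and "odd p"
  shows "(\<forall>\<alpha>::complex. poly (fekete_poly p) \<alpha> = 0 \<and> \<alpha> \<notin> {0, 1, -1} \<longrightarrow>
            poly (fekete_poly p) (1 / \<alpha>) = 0 \<and> 1 / \<alpha> \<notin> {0, 1, -1} \<and> 1 / \<alpha> \<noteq> \<alpha> \<and>
            Polynomial.order (1 / \<alpha>) (fekete_poly p) = Polynomial.order \<alpha> (fekete_poly p)) \<and>
         (\<forall>\<alpha>::complex. poly (fekete_poly p) \<alpha> = 0 \<and> \<alpha> \<noteq> 0 \<longrightarrow>
            \<alpha> \<in> {r. 1 / 2 < norm r \<and> norm r < 2})"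
proof (intro conjI allI impI)
  have "2 < p"
    using assms prime_gt_1_nat[of p] by (cases "p = 2") auto
  note p = \<open>prime p\<close> \<open>2 < p\<close>
  {
    fix \<alpha> :: complex
    assume \<alpha>: "poly (fekete_poly p) \<alpha> = 0 \<and> \<alpha> \<notin> {0, 1, -1}"
    then show "poly (fekete_poly p) (1 / \<alpha>) = 0"
      using poly_fekete_inverse_eq_0_iff[OF p] by simp
    show "1 / \<alpha> \<notin> {0, 1, -1}"
      using \<alpha> by (auto simp: divide_eq_eq dest: minus_equation_iff[THEN iffD1])
    show "1 / \<alpha> \<noteq> \<alpha>"
      using \<alpha> by (auto simp: divide_eq_eq square_eq_1_iff)
    show "Polynomial.order (1 / \<alpha>) (fekete_poly p) = Polynomial.order \<alpha> (fekete_poly p)"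
      using \<alpha> order_fekete_inverse[OF p] by simp
  next
    fix \<alpha> :: complex
    assume \<alpha>: "poly (fekete_poly p) \<alpha> = 0 \<and> \<alpha> \<noteq> 0"
    then have "norm \<alpha> < 2" "norm (1 / \<alpha>) < 2"
      using norm_fekete_root_less_2[OF p(1)] poly_fekete_inverse_eq_0_iff[OF p] by simp_all
    then show "\<alpha> \<in> {r. 1 / 2 < norm r \<and> norm r < 2}"
      using \<alpha> by (simp add: norm_divide field_simps)
  }
qed

end
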